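(* Let $H$ be a hypergraph, and let $U$ and $V$ form an equal partition of hyperedges in $H$. If $\{X_t:t\in\mathbb{N}\cup\{0\}\}$ is a random walk on $H$ with uniform probability distribution, then $$\Pr(X_t\in U\mid X_{t-1}\notin U\cup V)=\Pr(X_t\in V\mid X_{t-1}\notin U\cup V)$$ for all $t\in\mathbb{N}$.
   Context: A hypergraph $H=(V(H),E(H))$ consists of a finite non-empty vertex set $V(H)$ and a set $E(H)\subseteq\mathcal{P}(V(H))$ of hyperedges, where $\mathcal{P}(V(H))$ is the power set of $V(H)$. The star of a vertex $v$ is $E_v(H)=\{e\in E(H):v\in e\}$. Two disjoint subsets $U,V\subseteq V(H)$ form an equal partition of hyperedges in $H$ if $|U\cap e|=|V\cap e|$ for all $e\in E(H)$. Here $\mathbb{N}$ denotes the positive integers. A random walk on $H$ is a time-homogeneous Markov chain $(X_t)_{t\in\mathbb{N}\cup\{0\}}$ with state space $V(H)$, initial distribution $\Pr(X_0=v)=q_v$ (with $q_v\in[0,1]$ and $\sum_{v\in V(H)}q_v=1$), and transition probabilities $\Pr(X_t=v\mid X_{t-1}=u)=P_{uv}=\sum_{e\in E_u(H)\cap E_v(H)}r_{ue}s^u_{ev}$, where for each $u\in V(H)$, $(r_{ue})_{e\in E_u(H)}$ is a probability distribution on $E_u(H)$ (the hyperedge distribution on $u$), and for each $u\in V(H)$ and $e\in E_u(H)$, $(s^u_{ev})_{v\in e}$ is a probability distribution on $e$ (the vertex distribution of $e$ on $u$). The probability distribution is called uniform if, for every $u\in V(H)$, $r_{ue}=r_{ue'}$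 for all $e,e'\in E_u(H)$, and, for every $e\in E_u(H)$, $s^u_{ev}=s^u_{ev'}$ for all $v,v'\in e\setminus\{u\}$ (the value $s^u_{eu}$ may be different, e.g. zero). For a set $W\subseteq V(H)$, $(X_t\in W)$ denotes the event $\bigcup_{u\in W}(X_t=u)$, and $(X_t\notin W)$ denotes the event $\bigcup_{u\in V(H)\setminus W}(X_t=u)$. *)

theory Defs
  imports "HOL-Probability.Probability"
begin

section \<open>Hypergraphs\<close>

record 'a pre_hypergraph =
  verts :: "'a set"
  edges :: "'a set set"

locale hypergraph =
  fixes H :: "'a pre_hypergraph"
  assumes finite_verts: "finite (verts H)"
    and verts_nonempty: "verts H \<noteq> {}"
    and edges_subset: "edges H \<subseteq> Pow (verts H)"

definition star :: "'a pre_hypergraph \<Rightarrow> 'a \<Rightarrow> 'a set set" where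
  "star H v = {e \<in> edges H. v \<in> e}"

definition equal_partition :: "'a pre_hypergraph \<Rightarrow> 'a set \<Rightarrow> 'a set \<Rightarrow> bool" where
  "equal_partition H U V \<longleftrightarrow>
     U \<subseteq> verts H \<and> V \<subseteq> verts H \<and> U \<inter> V = {} \<and>
     (\<forall>e\<in>edges H. card (U \<inter> e) = card (V \<inter> e))"

section \<open>Time-homogeneous Markov chains\<close>

text \<open>Only used for finite sets \<open>A\<close>; the sum being 1 forces \<open>A\<close> to be finite and non-empty.\<close>

definition prob_distribution_on :: "'b set \<Rightarrow> ('b \<Rightarrow> real) \<Rightarrow> bool" where
  "prob_distribution_on A f \<longleftrightarrow> (\<forall>a\<in>A. 0 \<le> f a \<and> f a \<le> 1) \<and> (\<Sum>a\<in>A. f a) = 1"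

text \<open>
  The chain has state space \<open>S\<close>, initial distribution \<open>q\<close> and transition probabilities \<open>P\<close>.
  Time-homogeneity is expressed by \<open>P\<close> not depending on the time. Conditional
  probabilities are only constrained when the conditioning event has positive probability.
\<close>

locale homogeneous_markov_chain = prob_space M
  for M :: "'w measure" and S :: "'a set" and X :: "nat \<Rightarrow> 'w \<Rightarrow> 'a"
    and q :: "'a \<Rightarrow> real" and P :: "'a \<Rightarrow> 'a \<Rightarrow> real" +
  assumes random_variable_X: "\<And>t. X t \<in> measurable M (count_space S)"
    and initial_distribution: "prob_distribution_on S q"
    and initial: "\<And>v. v \<in> S \<Longrightarrow> \<P>(\<omega> in M. X 0 \<omega> = v) = q v"
    and markov_property: "\<And>t x v. \<lbrakk>\<And>i. i \<le> t \<Longrightarrow> x i \<in> S; v \<in> S; \<P>(\<omega> in M. \<forall>i\<le>t. X i \<omega> = x i) > 0\<rbrakk> \<Longrightarrow>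
          \<P>(\<omega> in M. X (Suc t) \<omega> = v \<bar> \<forall>i\<le>t. X i \<omega> = x i) = \<P>(\<omega> in M. X (Suc t) \<omega> = v \<bar> X t \<omega> = x t)"
    and transition: "\<And>t u v. \<lbrakk>u \<in> S; v \<in> S; \<P>(\<omega> in M. X t \<omega> = u) > 0\<rbrakk> \<Longrightarrow>
          \<P>(\<omega> in M. X (Suc t) \<omega> = v \<bar> X t \<omega> = u) = P u v"

section \<open>Random walks on hypergraphs\<close>

text \<open>
  \<open>r u e\<close> is the probability of choosing the hyperedge \<open>e\<close> at \<open>u\<close>, and \<open>s u e v\<close> the
  probability of then moving from \<open>u\<close> to \<open>v\<close> within \<open>e\<close>.
\<close>

definition walk_transition ::
    "'a pre_hypergraph \<Rightarrow> ('a \<Rightarrow> 'a set \<Rightarrow> real) \<Rightarrow> ('a \<Rightarrow> 'a set \<Rightarrow> 'a \<Rightarrow> real) \<Rightarrow> 'a \<Rightarrow> 'a \<Rightarrow> real" where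
  "walk_transition H r s u v = (\<Sum>e\<in>star H u \<inter> star H v. r u e * s u e v)"

definition random_walk ::
    "'a pre_hypergraph \<Rightarrow> 'w measure \<Rightarrow> (nat \<Rightarrow> 'w \<Rightarrow> 'a) \<Rightarrow> ('a \<Rightarrow> real) \<Rightarrow>
     ('a \<Rightarrow> 'a set \<Rightarrow> real) \<Rightarrow> ('a \<Rightarrow> 'a set \<Rightarrow> 'a \<Rightarrow> real) \<Rightarrow> bool" where
  "random_walk H M X q r s \<longleftrightarrow>
     (\<forall>u\<in>verts H. prob_distribution_on (star H u) (r u)) \<and>
     (\<forall>u\<in>verts H. \<forall>e\<in>star H u. prob_distribution_on e (s u e)) \<and>
     homogeneous_markov_chain M (verts H) X q (walk_transition H r s)"

text \<open>The value \<open>s u e u\<close> is deliberately left unconstrained.\<close>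

definition uniform_walk ::
    "'a pre_hypergraph \<Rightarrow> ('a \<Rightarrow> 'a set \<Rightarrow> real) \<Rightarrow> ('a \<Rightarrow> 'a set \<Rightarrow> 'a \<Rightarrow> real) \<Rightarrow> bool" where
  "uniform_walk H r s \<longleftrightarrow>
     (\<forall>u\<in>verts H.
        (\<forall>e\<in>star H u. \<forall>e'\<in>star H u. r u e = r u e') \<and>
        (\<forall>e\<in>star H u. \<forall>v\<in>e - {u}. \<forall>v'\<in>e - {u}. s u e v = s u e v'))"

end

theory Submission
  imports Defs
begin

text \<open>
  Fix a vertex \<open>u\<close> outside \<open>U \<union> V\<close>. A step from \<open>u\<close> first chooses a hyperedge \<open>e\<close> containing
  \<open>u\<close> and then a vertex of \<open>e\<close>, all vertices of \<open>e\<close> other than \<open>u\<close> being equally likely. As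
  \<open>u\<close> lies in neither \<open>U\<close> nor \<open>V\<close>, the chances of landing in \<open>U\<close> or in \<open>V\<close> through \<open>e\<close> are
  the same multiple of \<open>card (U \<inter> e)\<close> and \<open>card (V \<inter> e)\<close>, and these numbers agree. Averaging over
  \<open>e\<close> shows that the one-step probabilities from \<open>u\<close> into \<open>U\<close> and into \<open>V\<close> are equal
  (\<open>walk_transition_balanced\<close>).

  By the law of total probability (\<open>prob_step_between\<close>), the joint probability of being outside
  \<open>U \<union> V\<close> and then moving into a set \<open>W\<close> is the average of the one-step probabilities into \<open>W\<close>,
  with weights that do not depend on \<open>W\<close>. Hence the numerators of the two conditional probabilities
  agree, and their denominators are the same.
\<close>

context homogeneous_markov_chain
begin

lemma measurable_X_comp [measurable]: "X t \<in> measurable M (count_space S)"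
  by (rule random_variable_X)

text \<open>
  The chain leaves the conditional probability free where the conditioning event is null; the
  product form holds there as well, because both sides vanish.
\<close>

lemma prob_step:
  assumes "u \<in> S" "v \<in> S"
  shows "\<P>(\<omega> in M. X (Suc t) \<omega> = v \<and> X t \<omega> = u) = \<P>(\<omega> in M. X t \<omega> = u) * P u v"
proof (cases "\<P>(\<omega> in M. X t \<omega> = u) > 0")
  case True
  then show ?thesis
    using transition[OF assms True] by (simp add: cond_prob_def field_simps)
next
  case False
  then have null: "\<P>(\<omega> in M. X t \<omega> = u) = 0"
    by (simp add: zero_less_measure_iff)
  have "\<P>(\<omega> in M. X (Suc t) \<omega> = v \<and> X t \<omega> = u) \<le> \<P>(\<omega> in M. X t \<omega> = u)"
    using assms by (intro finite_measure_mono) auto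
  with null have "\<P>(\<omega> in M. X (Suc t) \<omega> = v \<and> X t \<omega> = u) = 0"
    by (simp add: measure_le_0_iff)
  with null show ?thesis by simp
qed

lemma prob_step_between:
  assumes "finite S" "A \<subseteq> S" "W \<subseteq> S"
  shows "\<P>(\<omega> in M. X (Suc t) \<omega> \<in> W \<and> X t \<omega> \<in> A) =
         (\<Sum>u\<in>A. \<P>(\<omega> in M. X t \<omega> = u) * (\<Sum>v\<in>W. P u v))"
proof -
  have fin: "finite A" "finite W"
    using assms finite_subset by blast+
  define E where "E = (\<lambda>(u, v). {\<omega> \<in> space M. X (Suc t) \<omega> = v \<and> X t \<omega> = u})"
  have E_event: "E p \<in> events" if "p \<in> A \<times> W" for p
    using that assms unfolding E_def by (auto split: prod.splits)
  have "{\<omega> \<in> space M. X (Suc t) \<omega> \<in> W \<and> X t \<omega> \<in> A} = (\<Union>p\<in>A \<times> W. E p)"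
    by (auto simp: E_def)
  then have "\<P>(\<omega> in M. X (Suc t) \<omega> \<in> W \<and> X t \<omega> \<in> A) = prob (\<Union>p\<in>A \<times> W. E p)"
    by simp
  also have "\<dots> = (\<Sum>p\<in>A \<times> W. prob (E p))"
    using fin E_event
    by (intro finite_measure_finite_Union) (auto simp: disjoint_family_on_def E_def)
  also have "\<dots> = (\<Sum>u\<in>A. \<Sum>v\<in>W. \<P>(\<omega> in M. X (Suc t) \<omega> = v \<and> X t \<omega> = u))"
    by (simp add: sum.cartesian_product E_def case_prod_unfold)
  also have "\<dots> = (\<Sum>u\<in>A. \<Sum>v\<in>W. \<P>(\<omega> in M. X t \<omega> = u) * P u v)"
    using assms by (intro sum.cong refl prob_step) auto
  finally show ?thesis
    by (simp add: sum_distrib_left)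
qed

end

lemma (in hypergraph) finite_star: "finite (star H u)"
proof (rule finite_subset)
  show "star H u \<subseteq> Pow (verts H)"
    using edges_subset by (auto simp: star_def)
qed (simp add: finite_verts)

lemma (in hypergraph) sum_walk_transition:
  assumes "W \<subseteq> verts H"
  shows "(\<Sum>v\<in>W. walk_transition H r s u v) = (\<Sum>e\<in>star H u. r u e * (\<Sum>v\<in>W \<inter> e. s u e v))"
proof -
  have finW: "finite W"
    using assms finite_verts finite_subset by blast
  have "(\<Sum>v\<in>W. walk_transition H r s u v) =
        (\<Sum>v\<in>W. \<Sum>e\<in>star H u. if v \<in> e then r u e * s u e v else 0)"
  proof (intro sum.cong refl)
    fix v
    have "star H u \<inter> star H v = {e \<in> star H u. v \<in> e}"
      by (auto simp: star_def)
    then show "walk_transition H r s u v = (\<Sum>e\<in>star H u. if v \<in> e then r u e * s u e v else 0)"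
      by (simp add: walk_transition_def sum.inter_filter finite_star)
  qed
  also have "\<dots> = (\<Sum>e\<in>star H u. \<Sum>v\<in>W. if v \<in> e then r u e * s u e v else 0)"
    by (rule sum.swap)
  also have "\<dots> = (\<Sum>e\<in>star H u. r u e * (\<Sum>v\<in>W \<inter> e. s u e v))"
    using finW by (simp add: sum.inter_restrict[symmetric] sum_distrib_left)
  finally show ?thesis .
qed

text \<open>
  The condition \<open>u \<notin> U \<union> V\<close> is essential: uniformity leaves the probability \<open>s u e u\<close> of staying
  at \<open>u\<close> free, so the counting argument works only for sets that avoid \<open>u\<close>.
\<close>

lemma (in hypergraph) walk_transition_balanced:
  assumes part: "equal_partition H U V" and unif: "uniform_walk H r s"
    and u: "u \<in> verts H - (U \<union> V)"
  shows "(\<Sum>v\<in>U. walk_transition H r s u v) = (\<Sum>v\<in>V. walk_transition H r s u v)"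
proof -
  have "(\<Sum>v\<in>U \<inter> e. s u e v) = (\<Sum>v\<in>V \<inter> e. s u e v)" if e: "e \<in> star H u" for e
  proof -
    have "\<forall>v\<in>e - {u}. \<forall>v'\<in>e - {u}. s u e v = s u e v'"
      using unif u e unfolding uniform_walk_def by blast
    then have "\<exists>c. \<forall>v\<in>e - {u}. s u e v = c"
      by metis
    then obtain c where c: "s u e v = c" if "v \<in> e - {u}" for v
      by auto
    have sum_eq: "(\<Sum>v\<in>W \<inter> e. s u e v) = real (card (W \<inter> e)) * c" if "u \<notin> W" for W
    proof -
      have "(\<Sum>v\<in>W \<inter> e. s u e v) = (\<Sum>v\<in>W \<inter> e. c)"
        using that by (intro sum.cong refl c) auto
      then show ?thesis by simp
    qed
    have "card (U \<inter> e) = card (V \<inter> e)"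
      using part e by (auto simp: equal_partition_def star_def)
    then show ?thesis
      using u by (simp add: sum_eq)
  qed
  moreover have "U \<subseteq> verts H" "V \<subseteq> verts H"
    using part by (auto simp: equal_partition_def)
  ultimately show ?thesis
    by (simp add: sum_walk_transition)
qed

theorem theorem3p8:
  fixes H :: "'a pre_hypergraph" and M :: "'w measure" and X :: "nat \<Rightarrow> 'w \<Rightarrow> 'a"
    and q :: "'a \<Rightarrow> real" and r :: "'a \<Rightarrow> 'a set \<Rightarrow> real" and s :: "'a \<Rightarrow> 'a set \<Rightarrow> 'a \<Rightarrow> real"
    and U V :: "'a set" and t :: nat
  assumes "hypergraph H"
    and "equal_partition H U V"
    and "random_walk H M X q r s"
    and "uniform_walk H r s"
    and "t \<ge> 1"
  shows "\<P>(\<omega> in M. X t \<omega> \<in> U \<bar> X (t - 1) \<omega> \<in> verts H - (U \<union> V)) =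
         \<P>(\<omega> in M. X t \<omega> \<in> V \<bar> X (t - 1) \<omega> \<in> verts H - (U \<union> V))"
proof -
  interpret hypergraph H by fact
  interpret homogeneous_markov_chain M "verts H" X q "walk_transition H r s"
    using assms(3) by (simp add: random_walk_def)
  define A where "A = verts H - (U \<union> V)"
  obtain k where k: "t = Suc k"
    using assms(5) by (cases t) auto
  have sub: "A \<subseteq> verts H" "U \<subseteq> verts H" "V \<subseteq> verts H"
    using assms(2) by (auto simp: A_def equal_partition_def)
  have "(\<Sum>u\<in>A. \<P>(\<omega> in M. X k \<omega> = u) * (\<Sum>v\<in>U. walk_transition H r s u v)) =
        (\<Sum>u\<in>A. \<P>(\<omega> in M. X k \<omega> = u) * (\<Sum>v\<in>V. walk_transition H r s u v))"
    using walk_transition_balanced[OF assms(2,4)] by (intro sum.cong refl) (simp add: A_def)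
  then have "\<P>(\<omega> in M. X (Suc k) \<omega> \<in> U \<and> X k \<omega> \<in> A) = \<P>(\<omega> in M. X (Suc k) \<omega> \<in> V \<and> X k \<omega> \<in> A)"
    by (simp only: prob_step_between[OF finite_verts sub(1)] sub)
  then show ?thesis
    unfolding A_def[symmetric] by (simp add: cond_prob_def k)
qed

end
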